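(* Consider a single contract with total demand $D>0$ served over $k\ge 1$ optimization cycles of equal length. In every cycle the supply forecast predicts $P>0$ eligible impressions, while the actual number of eligible impressions in every cycle is $A>0$; let $r = 1 - A/P$ be the supply forecast error rate. Set $D_1 = D$, and for $i=1,\dots,k$ let the serving rate chosen at the start of cycle $i$ be $\rho_i = \dfrac{D_i}{(k-i+1)P}$ (the remaining demand divided by the predicted remaining supply), and let $D_{i+1} = D_i - \rho_i A$ (the remaining demand after the $\rho_i A$ impressions actually delivered in cycle $i$). Assume the contract is never infeasible, i.e. $0<\rho_i\le 1$ for all $i=1,\dots,k$. Define the underdelivery as $D_{k+1}/D$ and the overdelivery as $-D_{k+1}/D$. Then: (i) if $r>0$, the underdelivery is positive and at most $\dfrac{r+r^2}{k^{1-r}}$; (ii) if $r<0$, the overdelivery is positive and at most $\dfrac{|r|}{k^{1-r}}$.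
   Context: This models an ad server that periodically re-optimizes a contract's serving rate using a (possibly wrong) supply forecast: at each of the $k$ re-optimization points, the remaining demand is spread uniformly over the forecasted remaining supply, and the contract then receives that rate times the true supply of the cycle. *)

theory Defs
  imports Complex_Main
begin

definition forecast_error_rate :: "real \<Rightarrow> real \<Rightarrow> real" where
  "forecast_error_rate P A = 1 - A / P"

text \<open>
  Here \<open>Dem i\<close> is the demand remaining at the start of cycle \<open>i\<close>; cycles are numbered from \<open>1\<close>
  to \<open>k\<close>, and \<open>Dem 0\<close> and \<open>\<rho> 0\<close> are unconstrained. For \<open>i \<le> k\<close> the number \<open>k - i + 1\<close> of
  remaining cycles does not suffer from truncated subtraction.
\<close>

definition reoptimized_serving ::
    "nat \<Rightarrow> real \<Rightarrow> real \<Rightarrow> real \<Rightarrow> (nat \<Rightarrow> real) \<Rightarrow> (nat \<Rightarrow> real) \<Rightarrow> bool" where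
  "reoptimized_serving k D P A Dem \<rho> \<longleftrightarrow>
     Dem 1 = D \<and>
     (\<forall>i\<in>{1..k}. \<rho> i = Dem i / (real (k - i + 1) * P) \<and> Dem (i + 1) = Dem i - \<rho> i * A)"

definition underdelivery :: "nat \<Rightarrow> real \<Rightarrow> (nat \<Rightarrow> real) \<Rightarrow> real" where
  "underdelivery k D Dem = Dem (k + 1) / D"

definition overdelivery :: "nat \<Rightarrow> real \<Rightarrow> (nat \<Rightarrow> real) \<Rightarrow> real" where
  "overdelivery k D Dem = - Dem (k + 1) / D"

end

(*
  With j cycles left the remaining demand shrinks by the factor 1 - (A/P)/j = (j - 1 + r)/j, so
  D_{k+1}/D is the product of these factors, namely (r/k) times the product of 1 + r/m over
  1 <= m < k. Each factor is at most exp (r/m), and comparing 1/m with ln ((m+1)/m) (if r < 0) or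
  with ln (m/(m-1)) (if r > 0 and m >= 2) makes the product telescope to a power of k. For r > 0
  the factor m = 1 is kept as it is and yields the 1 + r in the bound.
*)
theory Submission
  imports Defs
begin

lemma powr_ratio_ge_of_nonpos:
  fixes r m :: real
  assumes "r \<le> 0" "m > 0"
  shows "1 + r / m \<le> ((m + 1) / m) powr r"
proof -
  have "ln ((m + 1) / m) \<le> 1 / m"
    using ln_add_one_self_le_self[of "1 / m"] assms by (simp add: add_divide_distrib)
  then have "r * (1 / m) \<le> r * ln ((m + 1) / m)"
    using assms by (intro mult_left_mono_neg) auto
  then have "exp (r / m) \<le> ((m + 1) / m) powr r"
    using assms by (simp add: powr_def)
  then show ?thesis
    using exp_ge_add_one_self[of "r / m"] by linarith
qed

text \<open>For this sign of \<open>r\<close> the logarithm must be bounded from below, and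
  \<open>ln ((m + 1) / m)\<close> dominates only \<open>1 / (m + 1)\<close>. Hence the shifted
  denominator on the left.\<close>

lemma powr_ratio_ge_of_nonneg:
  fixes r m :: real
  assumes "r \<ge> 0" "m > 0"
  shows "1 + r / (m + 1) \<le> ((m + 1) / m) powr r"
proof -
  have "ln (m / (m + 1)) \<le> m / (m + 1) - 1"
    using assms by (intro ln_le_minus_one) auto
  then have "1 / (m + 1) \<le> ln ((m + 1) / m)"
    using assms by (simp add: ln_div field_simps)
  then have "r * (1 / (m + 1)) \<le> r * ln ((m + 1) / m)"
    using assms by (intro mult_left_mono) auto
  then have "exp (r / (m + 1)) \<le> ((m + 1) / m) powr r"
    using assms by (simp add: powr_def)
  then show ?thesis
    using exp_ge_add_one_self[of "r / (m + 1)"] by linarith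
qed

text \<open>The quotient is the product of \<open>1 + r / m\<close> for \<open>m\<close> from 1 to
  \<open>n\<close>; peeling off the last factor drives the two inductions below.\<close>

lemma pochhammer_over_fact_Suc:
  fixes r :: real
  shows "pochhammer (1 + r) (Suc n) / fact (Suc n)
    = pochhammer (1 + r) n / fact n * (1 + r / real (Suc n))"
proof -
  have "1 + r / real (Suc n) = (1 + r + real n) / real (Suc n)"
    by (simp add: field_simps)
  then show ?thesis
    by (simp add: pochhammer_Suc)
qed

lemma pochhammer_over_fact_le_of_nonpos:
  fixes r :: real
  assumes "-1 \<le> r" "r \<le> 0"
  shows "pochhammer (1 + r) n / fact n \<le> real (Suc n) powr r"
proof (induction n)
  case (Suc n)
  \<comment> \<open>Keeps the new factor nonnegative, so that the two upper bounds may be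
    multiplied.\<close>
  have "-1 \<le> r / real (Suc n)"
    using assms by (simp add: field_simps)
  then have "pochhammer (1 + r) (Suc n) / fact (Suc n)
    \<le> real (Suc n) powr r * ((real (Suc n) + 1) / real (Suc n)) powr r"
    unfolding pochhammer_over_fact_Suc
    using Suc powr_ratio_ge_of_nonpos[of r "real (Suc n)"] assms
    by (intro mult_mono) auto
  also have "\<dots> = real (Suc (Suc n)) powr r"
    by (simp add: powr_divide add.commute)
  finally show ?case .
qed simp

text \<open>The induction starts from the exact factor \<open>1 + r\<close>; only the later factors
  are estimated and telescope.\<close>

lemma pochhammer_over_fact_le_of_nonneg:
  fixes r :: real
  assumes "r \<ge> 0"
  shows "pochhammer (1 + r) (Suc n) / fact (Suc n) \<le> (1 + r) * real (Suc n) powr r"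
proof (induction n)
  case (Suc n)
  have "pochhammer (1 + r) (Suc (Suc n)) / fact (Suc (Suc n))
    \<le> (1 + r) * real (Suc n) powr r * ((real (Suc n) + 1) / real (Suc n)) powr r"
    unfolding pochhammer_over_fact_Suc[of r "Suc n"]
    using Suc powr_ratio_ge_of_nonneg[of r "real (Suc n)"] assms
    by (intro mult_mono) (auto simp: add.commute)
  also have "\<dots> = (1 + r) * real (Suc (Suc n)) powr r"
    by (simp add: powr_divide add.commute)
  finally show ?case .
qed simp

text \<open>Counting back from the end, \<open>Suc j\<close> cycles are left when cycle
  \<open>k - j\<close> starts, so the factor depends on \<open>j\<close> alone.\<close>

lemma reoptimized_serving_step:
  assumes "reoptimized_serving k D P A Dem \<rho>" "P > 0" "j < k"
  shows "Dem (k + 1 - j) =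
    Dem (k - j) * (forecast_error_rate P A + real j) / real (Suc j)"
proof -
  have "k - j \<in> {1..k}" "k - (k - j) + 1 = Suc j" "k + 1 - j = k - j + 1"
    using assms(3) by auto
  then have "\<rho> (k - j) = Dem (k - j) / (real (Suc j) * P)"
    and "Dem (k + 1 - j) = Dem (k - j) - \<rho> (k - j) * A"
    using assms(1) unfolding reoptimized_serving_def by metis+
  then have "Dem (k + 1 - j) = Dem (k - j) - Dem (k - j) / (real (Suc j) * P) * A"
    by (simp only:)
  also have "\<dots> = Dem (k - j) * (forecast_error_rate P A + real j) / real (Suc j)"
  proof -
    have "x - x / (c * P) * A = x * (1 - A / P + (c - 1)) / c" if "c > 0" for x c :: real
      using that assms(2) by (simp add: field_simps)
    from this[of "real (Suc j)" "Dem (k - j)"] show ?thesis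
      by (simp add: forecast_error_rate_def)
  qed
  finally show ?thesis .
qed

lemma reoptimized_serving_final_demand:
  assumes "reoptimized_serving k D P A Dem \<rho>" "P > 0" "j \<le> k"
  shows "Dem (k + 1) = Dem (k + 1 - j) * (pochhammer (forecast_error_rate P A) j / fact j)"
  using assms(3)
proof (induction j)
  case (Suc j)
  then show ?case
    using reoptimized_serving_step[OF assms(1,2), of j] by (simp add: pochhammer_Suc)
qed simp

theorem theorem1:
  fixes k :: nat and D P A r :: real and Dem \<rho> :: "nat \<Rightarrow> real"
  assumes "k \<ge> 1" and "D > 0" and "P > 0" and "A > 0"
    and "r = forecast_error_rate P A"
    and "reoptimized_serving k D P A Dem \<rho>"
    and "\<forall>i\<in>{1..k}. 0 < \<rho> i \<and> \<rho> i \<le> 1"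
  shows "(r > 0 \<longrightarrow>
            0 < underdelivery k D Dem \<and>
            underdelivery k D Dem \<le> (r + r\<^sup>2) / real k powr (1 - r)) \<and>
         (r < 0 \<longrightarrow>
            0 < overdelivery k D Dem \<and>
            overdelivery k D Dem \<le> \<bar>r\<bar> / real k powr (1 - r))"
proof -
  obtain n where k: "k = Suc n"
    using assms(1) by (cases k) auto
  \<comment> \<open>What remains of \<open>pochhammer r k / fact k\<close> once \<open>r / k\<close>
    is split off.\<close>
  define Q where "Q = pochhammer (1 + r) n / fact n"
  have under: "underdelivery k D Dem = r * Q / real k"
    using reoptimized_serving_final_demand[OF assms(6,3) order.refl] assms(2,5,6)
    by (simp add: underdelivery_def reoptimized_serving_def Q_def k pochhammer_rec add.commute)
  have over: "overdelivery k D Dem = - (r * Q / real k)"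
    using under by (simp add: overdelivery_def underdelivery_def)
  have Dem_pos: "Dem i > 0" if "i \<in> {1..k}" for i
  proof -
    have "\<rho> i = Dem i / (real (k - i + 1) * P)" "\<rho> i > 0"
      using assms(6,7) that unfolding reoptimized_serving_def by auto
    moreover have "real (k - i + 1) * P > 0"
      using assms(3) by simp
    ultimately show ?thesis
      by (metis zero_less_divide_iff less_asym)
  qed
  \<comment> \<open>The last cycle multiplies the demand by exactly \<open>r\<close>, so with
    \<open>Dem k > 0\<close> the sign of the result is that of \<open>r\<close>, whatever the sign
    of \<open>Q\<close>.\<close>
  have "r * Q / real k = Dem k * r / D"
    using under reoptimized_serving_step[OF assms(6,3), of 0] assms(1,5)
    by (simp add: underdelivery_def)
  moreover have "Dem k > 0"
    using Dem_pos assms(1) by simp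
  ultimately have pos: "r > 0 \<Longrightarrow> r * Q / real k > 0" and neg: "r < 0 \<Longrightarrow> r * Q / real k < 0"
    using assms(2) by (simp_all add: mult_pos_neg divide_neg_pos)
  have powr_k: "c / real k powr (1 - r) = c * real k powr r / real k" for c
    using k by (simp add: powr_diff)
  have bound_pos: "Q \<le> (1 + r) * real k powr r" if r: "r > 0"
  proof (cases n)
    case 0
    then show ?thesis using r by (simp add: Q_def k)
  next
    case (Suc m)
    have "Q \<le> (1 + r) * real n powr r"
      using pochhammer_over_fact_le_of_nonneg[of r m] r by (simp add: Q_def Suc)
    \<comment> \<open>Telescoping reached only \<open>n = k - 1\<close>; \<open>r > 0\<close> allows
      enlarging the base to \<open>k\<close>.\<close>
    also have "\<dots> \<le> (1 + r) * real k powr r"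
      using r by (intro mult_left_mono powr_mono2) (auto simp: k)
    finally show ?thesis .
  qed
  have bound_neg: "Q \<le> real k powr r" if r: "r < 0"
  proof (cases n)
    case 0
    then show ?thesis by (simp add: Q_def k)
  next
    case (Suc m)
    \<comment> \<open>Feasibility forces \<open>r > -1\<close> through the last cycle but one, whose
      factor is \<open>(r + 1) / 2\<close>. For \<open>k = 1\<close> that cycle does not exist, but
      then \<open>Q\<close> is the empty product.\<close>
    have "Dem k = Dem (k - 1) * (r + 1) / 2"
      using reoptimized_serving_step[OF assms(6,3), of 1] assms(5) by (simp add: k Suc)
    moreover have "Dem k > 0" "Dem (k - 1) > 0"
      using Dem_pos by (simp_all add: k Suc)
    ultimately have "0 < Dem (k - 1) * (r + 1)"
      by linarith
    then have "r > -1"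
      using zero_less_mult_pos[of "Dem (k - 1)" "r + 1"] \<open>Dem (k - 1) > 0\<close> by simp
    then show ?thesis
      using pochhammer_over_fact_le_of_nonpos[of r n] r by (simp add: Q_def k)
  qed
  have "r * Q / real k \<le> (r + r\<^sup>2) * real k powr r / real k" if "r > 0"
    using mult_left_mono[OF bound_pos[OF that], of r] that
    by (intro divide_right_mono) (auto simp: algebra_simps power2_eq_square)
  moreover have "- (r * Q / real k) \<le> \<bar>r\<bar> * real k powr r / real k" if "r < 0"
    using divide_right_mono[OF mult_left_mono[OF bound_neg[OF that], of "- r"], of "real k"] that
    by simp
  ultimately show ?thesis
    unfolding powr_k under over using pos neg by auto
qed

end
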